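(* $\mathcal{N}\setminus\mathcal{I}_{\mathbb{FSP}}\ne\emptyset$.
   Context: A tree is a nonempty set $p \subseteq 2^{<\omega}$ closed under initial segments ($\trianglelefteq$ denotes the initial segment relation and $\triangleleft$ its strict version; $|t|$ is the length of $t$). A node $t\in p$ is splitting if both $t^\frown 0, t^\frown 1 \in p$; $\mathrm{Split}(p)$ is the set of splitting nodes. $p$ is perfect if every node of $p$ is extended (not necessarily properly) by a splitting node of $p$. $\mathrm{Lev}_n(p)=\{t\in p: |t|=n\}$, $p\upharpoonright t=\{s\in p : s\trianglelefteq t \text{ or } t\triangleleft s\}$, and $[p]=\{f\in 2^\omega : \forall n\, (f\upharpoonright n\in p)\}$. $\mathbb{FSP}$ (fat splitting tree forcing) is the set of perfect trees $p\subseteq 2^{<\omega}$ such that for every $t\in p$ there is $k\in\omega$ such that for every $n\in\omega$ with $n\ge k-1$ there is $t'\in \mathrm{Lev}_n(p\upharpoonright t)$ with $t'\in\mathrm{Split}(p)$; ordered by $q\le p$ iff $q\subseteq p$. $X\subseteq 2^\omega$ is $\mathbb{FSP}$-nowhere dense if $\forall p\in\mathbb{FSP}\,\exists q\le p\ ([q]\cap X=\emptyset)$; $\mathcal{I}_{\mathbb{FSP}}$ is the $\sigma$-ideal of sets included in a countable union of $\mathbb{FSP}$-nowhere dense sets. $\mathcal{N}$ is the $\sigma$-ideal of measure zero subsets of $2^\omega$ for the standard product measure $\mu$. *)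

theory Defs
  imports "HOL-Probability.Probability" "HOL-Library.Sublist"
begin

(* Nodes of 2^{<omega} are boolean lists, ordered by prefix / strict_prefix;
   points of 2^omega are functions nat => bool. *)

type_synonym node = "bool list"
type_synonym point = "nat \<Rightarrow> bool"

definition is_tree :: "node set \<Rightarrow> bool" where
  "is_tree p \<longleftrightarrow> p \<noteq> {} \<and> (\<forall>t\<in>p. \<forall>s. prefix s t \<longrightarrow> s \<in> p)"

definition Split :: "node set \<Rightarrow> node set" where
  "Split p = {t \<in> p. t @ [False] \<in> p \<and> t @ [True] \<in> p}"

definition perfect_tree :: "node set \<Rightarrow> bool" where
  "perfect_tree p \<longleftrightarrow> is_tree p \<and> (\<forall>t\<in>p. \<exists>s\<in>Split p. prefix t s)"

definition Lev :: "nat \<Rightarrow> node set \<Rightarrow> node set" where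
  "Lev n p = {t \<in> p. length t = n}"

definition tree_restrict :: "node set \<Rightarrow> node \<Rightarrow> node set" where
  "tree_restrict p t = {s \<in> p. prefix s t \<or> strict_prefix t s}"

definition branches :: "node set \<Rightarrow> point set" where
  "branches p = {f. \<forall>n. map f [0..<n] \<in> p}"

(* The subtraction k - 1 is truncated, which is harmless: for k = 0 the condition
   on n is vacuous over the integers as well as over nat. *)

definition FSP :: "node set set" where
  "FSP = {p. perfect_tree p \<and>
     (\<forall>t\<in>p. \<exists>k::nat. \<forall>n\<ge>k - 1. \<exists>t'\<in>Lev n (tree_restrict p t). t' \<in> Split p)}"

definition FSP_le :: "node set \<Rightarrow> node set \<Rightarrow> bool" where
  "FSP_le q p \<longleftrightarrow> q \<in> FSP \<and> p \<in> FSP \<and> q \<subseteq> p"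

definition FSP_nowhere_dense :: "point set \<Rightarrow> bool" where
  "FSP_nowhere_dense X \<longleftrightarrow> (\<forall>p\<in>FSP. \<exists>q. FSP_le q p \<and> branches q \<inter> X = {})"

(* Since the empty set is nowhere dense, sequences cover finite unions too. *)

definition I_FSP :: "point set set" where
  "I_FSP = {X. \<exists>A::nat \<Rightarrow> point set. (\<forall>n. FSP_nowhere_dense (A n)) \<and> X \<subseteq> (\<Union>n. A n)}"

definition cantor_measure :: "point measure" where
  "cantor_measure = PiM UNIV (\<lambda>_. measure_pmf (bernoulli_pmf (1/2)))"

(* The completion makes every subset of a measurable null set a null set,
   as needed for an ideal. *)

definition null_ideal :: "point set set" where
  "null_ideal = null_sets (completion cantor_measure)"

end

theory Submission
  imports Defs
begin

text \<open>
  The body of any fat splitting tree \<open>p\<close> lies outside \<open>I_FSP\<close>: given countably many nowhere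
  dense sets, shrink \<open>p\<close> successively to avoid one after the other.  A single branch common to
  all the shrunken trees already contradicts a covering by these sets, and compactness of Cantor
  space provides such a branch (\<open>decreasing_FSP_common_branch\<close>, \<open>branches_notin_I_FSP\<close>).

  It remains to exhibit a fat splitting tree with a null body.  The sequences without two
  consecutive ones form such a tree.  It is fat because a node that ends in zero splits and zeros
  can always be appended, so that above every node there is a splitting node on every higher level
  (\<open>no_consecutive_True_FSP\<close>).
  Its body is null because each of the disjoint blocks of positions \<open>2i, 2i + 1\<close> takes
  at most three of its four possible values (\<open>branches_no_consecutive_True_null\<close>).
\<close>

lemma FSP_prefix_closed: "p \<in> FSP \<Longrightarrow> t \<in> p \<Longrightarrow> prefix s t \<Longrightarrow> s \<in> p"
  unfolding FSP_def perfect_tree_def is_tree_def by blast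

lemma FSP_Nil: "p \<in> FSP \<Longrightarrow> [] \<in> p"
  unfolding FSP_def perfect_tree_def is_tree_def by auto

text \<open>The tree has no leaves: the splitting node above \<open>t\<close> is \<open>t\<close> itself or has a
  child of \<open>t\<close> as an initial segment.\<close>

lemma FSP_child:
  assumes "p \<in> FSP" "t \<in> p"
  shows "\<exists>b. t @ [b] \<in> p"
proof -
  obtain s where s: "s \<in> Split p" "prefix t s"
    using assms unfolding FSP_def perfect_tree_def by blast
  then obtain u where u: "s @ [True] = t @ u @ [True]" by (auto simp: prefix_def)
  have "s @ [True] \<in> p" using s by (auto simp: Split_def)
  moreover have "prefix (t @ [hd (u @ [True])]) (s @ [True])"
    unfolding u by (cases u) auto
  ultimately show ?thesis using FSP_prefix_closed[OF assms(1)] by blast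
qed

text \<open>This is compactness of Cantor space in the form of Koenig's lemma.  A node that lies in all
  trees has a child in all of them: otherwise each child is missing from some tree, hence from every
  later one, and the later of these two trees has a leaf.\<close>

lemma decreasing_FSP_common_branch:
  fixes q :: "nat \<Rightarrow> node set"
  assumes FSP: "\<And>n. q n \<in> FSP" and dec: "\<And>n. q (Suc n) \<subseteq> q n"
  shows "(\<Inter>n. branches (q n)) \<noteq> {}"
proof -
  have anti: "q n \<subseteq> q m" if "m \<le> n" for m n
    using lift_Suc_antimono_le[of q, OF dec that] .
  have child: "\<exists>b. \<forall>m. t @ [b] \<in> q m" if "\<forall>m. t \<in> q m" for t
  proof (rule ccontr)
    assume "\<nexists>b. \<forall>m. t @ [b] \<in> q m"
    then have missing: "\<exists>m. t @ [b] \<notin> q m" for b by simp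
    obtain m where m: "t @ [False] \<notin> q m" using missing[of False] by (rule exE)
    obtain n where n: "t @ [True] \<notin> q n" using missing[of True] by (rule exE)
    have "\<exists>b. t @ [b] \<in> q (max m n)" using FSP_child[OF FSP] that by simp
    then obtain b where b: "t @ [b] \<in> q (max m n)" by (rule exE)
    have "q (max m n) \<subseteq> q m" "q (max m n) \<subseteq> q n" by (auto intro!: anti)
    then show False using b m n by (cases b) auto
  qed
  have "\<exists>t. \<forall>n. (length (t n) = n \<and> (\<forall>m. t n \<in> q m)) \<and> (\<exists>b. t (Suc n) = t n @ [b])"
  proof (rule dependent_nat_choice)
    show "\<exists>t. length t = 0 \<and> (\<forall>m. t \<in> q m)" using FSP_Nil FSP by auto
  next
    fix t n assume t: "length t = n \<and> (\<forall>m. t \<in> q m)"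
    then obtain b where "\<forall>m. t @ [b] \<in> q m" using child by blast
    with t show "\<exists>s. (length s = Suc n \<and> (\<forall>m. s \<in> q m)) \<and> (\<exists>b. s = t @ [b])"
      by (intro exI[of _ "t @ [b]"]) simp
  qed
  then obtain t where len: "\<And>n. length (t n) = n" and mem: "\<And>n m. t n \<in> q m"
    and ext: "\<And>n. \<exists>b. t (Suc n) = t n @ [b]" by blast
  define f where "f i = last (t (Suc i))" for i
  have "map f [0..<n] = t n" for n
  proof (induction n)
    case 0
    then show ?case using len[of 0] by simp
  next
    case (Suc n)
    then show ?case using ext[of n] by (auto simp: f_def)
  qed
  then have "f \<in> branches (q m)" for m using mem by (simp add: branches_def)
  then show ?thesis by blast
qed

lemma branches_mono: "p \<subseteq> q \<Longrightarrow> branches p \<subseteq> branches q"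
  unfolding branches_def by blast

lemma branches_notin_I_FSP:
  assumes "p \<in> FSP"
  shows "branches p \<notin> I_FSP"
proof
  assume "branches p \<in> I_FSP"
  then obtain A :: "nat \<Rightarrow> point set"
    where nd: "\<And>n. FSP_nowhere_dense (A n)" and cover: "branches p \<subseteq> (\<Union>n. A n)"
    unfolding I_FSP_def by blast
  have "\<exists>q. \<forall>n. (q n \<in> FSP \<and> q n \<subseteq> p) \<and> (FSP_le (q (Suc n)) (q n) \<and> branches (q (Suc n)) \<inter> A n = {})"
  proof (rule dependent_nat_choice)
    show "\<exists>q. q \<in> FSP \<and> q \<subseteq> p" using assms by blast
  next
    fix q n assume "q \<in> FSP \<and> q \<subseteq> p"
    then show "\<exists>r. (r \<in> FSP \<and> r \<subseteq> p) \<and> FSP_le r q \<and> branches r \<inter> A n = {}"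
      using nd[of n] unfolding FSP_nowhere_dense_def FSP_le_def by (metis order_trans)
  qed
  then obtain q where q: "\<forall>n. (q n \<in> FSP \<and> q n \<subseteq> p) \<and>
      (FSP_le (q (Suc n)) (q n) \<and> branches (q (Suc n)) \<inter> A n = {})"
    by (rule exE)
  have sub: "q n \<subseteq> p" and avoid: "branches (q (Suc n)) \<inter> A n = {}" for n
    using q by auto
  have "(\<Inter>n. branches (q n)) \<noteq> {}"
    by (rule decreasing_FSP_common_branch) (use q in \<open>auto simp: FSP_le_def\<close>)
  then obtain f where f: "\<And>n. f \<in> branches (q n)" by blast
  then have "f \<in> branches p" using branches_mono[OF sub[of 0]] by blast
  then show False using cover avoid f by blast
qed

definition no_consecutive_True :: "node set" where
  "no_consecutive_True = {t. successively (\<lambda>a b. \<not> (a \<and> b)) t}"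

text \<open>An appended block of at least one zero separates \<open>t\<close> from whatever follows.\<close>

lemma no_consecutive_True_pad:
  assumes "t \<in> no_consecutive_True"
  shows "t @ replicate (Suc j) False \<in> Split no_consecutive_True"
proof -
  have "successively (\<lambda>a b. \<not> (a \<and> b)) (replicate (Suc j) False @ u)"
    if "successively (\<lambda>a b. \<not> (a \<and> b)) u" for j u
    using that by (induction j) (auto simp: successively_Cons)
  from this[of "[]"] this[of "[False]"] this[of "[True]"] show ?thesis
    using assms by (auto simp: Split_def no_consecutive_True_def successively_append_iff)
qed

lemma no_consecutive_True_FSP: "no_consecutive_True \<in> FSP"
proof -
  have tree: "is_tree no_consecutive_True"
    unfolding is_tree_def
  proof
    have "[] \<in> no_consecutive_True" by (simp add: no_consecutive_True_def)
    then show "no_consecutive_True \<noteq> {}" by blast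
    show "\<forall>t\<in>no_consecutive_True. \<forall>s. prefix s t \<longrightarrow> s \<in> no_consecutive_True"
      by (auto simp: no_consecutive_True_def prefix_def successively_append_iff)
  qed
  moreover have "\<exists>s\<in>Split no_consecutive_True. prefix t s" if "t \<in> no_consecutive_True" for t
    using no_consecutive_True_pad[OF that, of 0] by (meson prefixI)
  moreover have "\<exists>k. \<forall>n\<ge>k - 1. \<exists>t'\<in>Lev n (tree_restrict no_consecutive_True t).
      t' \<in> Split no_consecutive_True" if t: "t \<in> no_consecutive_True" for t
  \<comment> \<open>One level is spent on the separating zero, another on the shift in \<open>k - 1\<close>.\<close>
  proof (intro exI[of _ "length t + 2"] allI impI)
    fix n assume "n \<ge> length t + 2 - 1"
    then obtain j where j: "n = length t + Suc j"
      using le_Suc_ex[of "Suc (length t)" n] by auto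
    define s where "s = t @ replicate (Suc j) False"
    have "s \<in> Split no_consecutive_True"
      unfolding s_def by (rule no_consecutive_True_pad[OF t])
    moreover have "strict_prefix t s"
      unfolding s_def by (simp add: strict_prefix_def)
    moreover have "length s = n" by (simp add: s_def j)
    ultimately show "\<exists>t'\<in>Lev n (tree_restrict no_consecutive_True t). t' \<in> Split no_consecutive_True"
      by (auto simp: Lev_def tree_restrict_def Split_def)
  qed
  ultimately show ?thesis unfolding FSP_def perfect_tree_def by blast
qed

text \<open>Two more levels multiply the number of nodes by at most three, since the last two entries
  are not both one.\<close>

lemma card_Lev_no_consecutive_True:
  "finite (Lev (2 * n) no_consecutive_True) \<and> card (Lev (2 * n) no_consecutive_True) \<le> 3 ^ n"
proof (induction n)
  case 0
  have "Lev 0 no_consecutive_True = {[]}" by (auto simp: Lev_def no_consecutive_True_def)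
  then show ?case by simp
next
  case (Suc n)
  define B where "B = {[False, False], [False, True], [True, False]}"
  define C where "C = Lev (2 * n) no_consecutive_True \<times> B"
  have sub: "Lev (2 * Suc n) no_consecutive_True \<subseteq> (\<lambda>(t, u). t @ u) ` C"
  proof
    fix s assume s: "s \<in> Lev (2 * Suc n) no_consecutive_True"
    define t u where "t = take (2 * n) s" and "u = drop (2 * n) s"
    have st: "s = t @ u" by (simp add: t_def u_def)
    have "length u = Suc (Suc 0)" and lt: "length t = 2 * n"
      using s by (auto simp: Lev_def t_def u_def)
    then obtain a b where u: "u = [a, b]" by (auto simp: length_Suc_conv)
    have "t \<in> no_consecutive_True" "\<not> (a \<and> b)"
      using s by (auto simp: Lev_def no_consecutive_True_def st u successively_append_iff)
    then have "(t, u) \<in> C" using lt u by (cases a; cases b) (auto simp: C_def B_def Lev_def)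
    then show "s \<in> (\<lambda>(t, u). t @ u) ` C" using st by force
  qed
  have fin: "finite C" using Suc by (simp add: C_def B_def)
  have "card (Lev (2 * Suc n) no_consecutive_True) \<le> card C"
    using sub fin by (meson card_image_le card_mono finite_imageI order_trans)
  also have "\<dots> = card (Lev (2 * n) no_consecutive_True) * 3"
    by (simp add: C_def B_def card_cartesian_product)
  finally show ?case using Suc sub fin by (auto intro: finite_subset)
qed

lemma cylinder_cantor_measure:
  fixes t :: node
  defines "C \<equiv> {f. map f [0..<length t] = t}"
  shows "C \<in> sets cantor_measure" and "emeasure cantor_measure C = (1/2) ^ length t"
proof -
  let ?M = "\<lambda>_::nat. measure_pmf (bernoulli_pmf (1/2))"
  interpret product_prob_space ?M UNIV
    ..
  have "prod_emb UNIV ?M {..<length t} (Pi\<^sub>E {..<length t} (\<lambda>i. {t ! i}))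
      = Pi\<^sub>E UNIV (\<lambda>i. if i \<in> {..<length t} then {t ! i} else space (?M i))"
    by (rule prod_emb_PiE) simp_all
  also have "\<dots> = {f. \<forall>i<length t. f i = t ! i}"
    by (rule set_eqI) (simp add: PiE_UNIV_domain Pi_iff if_split_mem2)
  also have "\<dots> = C"
  proof -
    have "map f [0..<length t] = t \<longleftrightarrow> (\<forall>i<length t. f i = t ! i)" for f
      by (subst list_eq_iff_nth_eq) simp
    then show ?thesis unfolding C_def by presburger
  qed
  finally have eq: "C = prod_emb UNIV ?M {..<length t} (Pi\<^sub>E {..<length t} (\<lambda>i. {t ! i}))"
    by (rule sym)
  show "C \<in> sets cantor_measure"
    unfolding eq cantor_measure_def by (rule sets_PiM_I) auto
  have "emeasure (measure_pmf (bernoulli_pmf (1/2))) {b} = 1/2" for b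
    by (cases b) (auto simp: emeasure_pmf_single ennreal_divide_numeral[of 1, simplified])
  moreover have "emeasure cantor_measure C
      = (\<Prod>i<length t. emeasure (?M i) {t ! i})"
    unfolding eq cantor_measure_def by (rule emeasure_PiM_emb) auto
  ultimately show "emeasure cantor_measure C = (1/2) ^ length t" by simp
qed

text \<open>The body is covered by at most \<open>3 ^ n\<close> cylinders of measure \<open>1 / 4 ^ n\<close>, for every
  \<open>n\<close>.\<close>

lemma branches_no_consecutive_True_null: "branches no_consecutive_True \<in> null_ideal"
proof -
  define Z where "Z n = (\<Union>t\<in>Lev (2 * n) no_consecutive_True. {f. map f [0..<length t] = t})" for n
  have meas: "Z n \<in> sets cantor_measure" for n
    unfolding Z_def using card_Lev_no_consecutive_True[of n] cylinder_cantor_measure(1)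
    by (intro sets.finite_UN) auto
  have bound: "emeasure cantor_measure (Z n) \<le> ennreal ((3/4) ^ n)" for n
  proof -
    have "emeasure cantor_measure (Z n) \<le> (\<Sum>t\<in>Lev (2 * n) no_consecutive_True.
        emeasure cantor_measure {f. map f [0..<length t] = t})"
      unfolding Z_def using card_Lev_no_consecutive_True[of n] cylinder_cantor_measure(1)
      by (intro emeasure_subadditive_finite) auto
    also have "\<dots> = (\<Sum>t\<in>Lev (2 * n) no_consecutive_True. ennreal ((1/4) ^ n))"
    proof (rule sum.cong[OF refl])
      fix t assume "t \<in> Lev (2 * n) no_consecutive_True"
      then have "length t = 2 * n" by (simp add: Lev_def)
      moreover have "(1/2 :: ennreal) ^ (2 * n) = ennreal ((1/2) ^ (2 * n))"
        by (simp add: ennreal_power[symmetric] ennreal_divide_numeral[of 1, simplified])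
      moreover have "(1/2 :: real) ^ (2 * n) = (1/4) ^ n"
        by (simp add: power_mult power2_eq_square)
      ultimately show "emeasure cantor_measure {f. map f [0..<length t] = t} = ennreal ((1/4) ^ n)"
        using cylinder_cantor_measure(2)[of t] by simp
    qed
    also have "\<dots> = ennreal (real (card (Lev (2 * n) no_consecutive_True)) * (1/4) ^ n)"
      by (simp add: ennreal_mult ennreal_of_nat_eq_real_of_nat)
    also have "\<dots> \<le> ennreal (3 ^ n * (1/4) ^ n)"
    proof (intro ennreal_leI mult_right_mono)
      show "real (card (Lev (2 * n) no_consecutive_True)) \<le> 3 ^ n"
        using card_Lev_no_consecutive_True[of n] by (metis of_nat_le_iff of_nat_numeral of_nat_power)
    qed simp
    also have "(3::real) ^ n * (1/4) ^ n = (3/4) ^ n"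
      by (simp add: power_mult_distrib[symmetric])
    finally show ?thesis .
  qed
  have "emeasure cantor_measure (\<Inter>n. Z n) \<le> ennreal ((3/4) ^ n)" for n
    by (rule order_trans[OF emeasure_mono[OF _ meas] bound]) auto
  moreover have "(\<lambda>n. ennreal ((3/4) ^ n)) \<longlonglongrightarrow> ennreal 0"
    by (intro tendsto_ennrealI LIMSEQ_power_zero) simp
  ultimately have "emeasure cantor_measure (\<Inter>n. Z n) \<le> 0"
    using LIMSEQ_le_const by fastforce
  moreover have "(\<Inter>n. Z n) \<in> sets cantor_measure" using meas by blast
  ultimately have "(\<Inter>n. Z n) \<in> null_sets cantor_measure" by auto
  moreover have "branches no_consecutive_True \<subseteq> (\<Inter>n. Z n)"
    by (auto simp: branches_def Z_def Lev_def)
  ultimately show ?thesis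
    unfolding null_ideal_def using null_sets_completion_subset null_sets_completionI by blast
qed

theorem corollary5p4:
  shows "null_ideal - I_FSP \<noteq> {}"
  using branches_no_consecutive_True_null branches_notin_I_FSP[OF no_consecutive_True_FSP] by blast

end
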